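(* Let $Q\in\mathrm M(\Omega)$ be conditionable. For $\lambda\in(0,1)$ define $$\Psi_\lambda:\ C^0([0,1];\mathcal X)\to C^0([0,1];\mathcal X\times\mathcal X),\qquad (t\mapsto\omega_t)\mapsto\big(t\mapsto(\omega_{\lambda t},\ \omega_{1-(1-\lambda)t})\big).$$ Then $Q$ is reciprocal if and only if for all $\lambda\in(0,1)$ the push-forward $Q_\lambda:=(\Psi_\lambda)_{\#}Q$ is Markov (as a path measure with state space $\mathcal X\times\mathcal X$).
   Context: $\mathcal X$ is a Polish space, $\Omega=C^0([0,1];\mathcal X)$ is the set of continuous paths with the topology of uniform convergence and its Borel $\sigma$-field, and $X_t(\omega)=\omega(t)$ is the canonical process; for $\mathcal T\subset[0,1]$, $X_{\mathcal T}=(X_t)_{t\in\mathcal T}$. $\mathrm M(\Omega)$ is the set of (nonnegative) Borel measures on $\Omega$; $Q_t$ is the image of $Q$ by $X_t$. A path measure $Q$ is conditionable if $Q_t$ is $\sigma$-finite for every $t\in[0,1]$. $Q$ is Markov if it is conditionable and for every $t\in[0,1]$, $A\in\sigma(X_{[0,t]})$, $B\in\sigma(X_{[t,1]})$: $Q(A\cap B\mid X_t)=Q(A\mid X_t)Q(B\mid X_t)$, $Q$-a.e. The same definitions apply to measures on $C^0([0,1];\mathcal X\times\mathcal X)$ with its own canonical process. $Q$ is reciprocal if it is conditionable and for all $0<s<u<1$, $A\in\sigma(X_{[0,s]},X_{[u,1]})$, $B\in\sigma(X_{[s,u]})$: $Q(A\cap B\mid X_s,X_u)=Q(A\mid X_s,X_u)\,Q(B\mid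 X_s,X_u)$, $Q$-a.e. *)

theory Defs
  imports "HOL-Probability.Probability"
begin

instance prod :: (polish_space, polish_space) polish_space ..

text \<open>
  A path is represented by a function on the real line that is extensional on \<open>{0..1}\<close>, i.e. it has
  the junk value \<^const>\<open>undefined\<close> off the unit interval. The library's space of bounded continuous
  functions carries the sup metric, hence the topology of uniform convergence; boundedness is
  automatic on the compact interval, see \<open>mspace_path_metric\<close> below.
\<close>

definition path_metric :: "(real \<Rightarrow> 'a::polish_space) metric" where
  "path_metric = cfunspace (top_of_set {0..1}) euclidean_metric"

lemma mspace_path_metric:
  "mspace path_metric = {\<omega>. \<omega> \<in> extensional {0..1} \<and> continuous_on {0..1} \<omega>}"
  unfolding path_metric_def
  by (subst compactin_mspace_cfunspace) auto

lemma mdist_path_metric_le: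
  assumes "\<omega> \<in> mspace path_metric" "\<omega>' \<in> mspace path_metric"
  shows "mdist path_metric \<omega> \<omega>' \<le> r \<longleftrightarrow> (\<forall>t\<in>{0..1}. dist (\<omega> t) (\<omega>' t) \<le> r)"
  using cfunspace_mdist_le [of \<omega> "top_of_set {0..1}" euclidean_metric \<omega>' r] assms
  by (simp add: path_metric_def del: mspace_cfunspace)

definition path_borel :: "(real \<Rightarrow> 'a::polish_space) measure" where
  "path_borel = sigma (mspace path_metric) {U. openin (mtopology_of path_metric) U}"

lemma openin_path_subset:
  "{U. openin (mtopology_of path_metric) U} \<subseteq> Pow (mspace path_metric)"
proof
  fix U assume "U \<in> {U. openin (mtopology_of path_metric) U}"
  then have "U \<subseteq> topspace (mtopology_of path_metric)"
    by (intro openin_subset) simp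
  then show "U \<in> Pow (mspace path_metric)"
    by simp
qed

lemma space_path_borel: "space path_borel = mspace path_metric"
  unfolding path_borel_def by (rule space_measure_of [OF openin_path_subset])

lemma sets_path_borel:
  "sets path_borel = sigma_sets (mspace path_metric) {U. openin (mtopology_of path_metric) U}"
  unfolding path_borel_def by (rule sets_measure_of [OF openin_path_subset])

lemma measurable_coordinate:
  assumes "t \<in> {0..1}"
  shows "(\<lambda>\<omega>. \<omega> t) \<in> measurable path_borel (borel :: 'a::polish_space measure)"
proof (rule borel_measurableI)
  fix S :: "'a set" assume "open S"
  have "continuous_map (mtopology_of path_metric) (mtopology_of (euclidean_metric :: 'a metric)) (\<lambda>\<omega>. \<omega> t)"
  proof (rule Lipschitz_continuous_imp_continuous_map)
    show "Lipschitz_continuous_map path_metric (euclidean_metric :: 'a metric) (\<lambda>\<omega>. \<omega> t)"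
      unfolding Lipschitz_continuous_map_def
    proof (intro conjI exI ballI)
      fix \<omega> \<omega>' :: "real \<Rightarrow> 'a"
      assume "\<omega> \<in> mspace path_metric" "\<omega>' \<in> mspace path_metric"
      from mdist_path_metric_le [OF this, of "mdist path_metric \<omega> \<omega>'"] assms
      show "mdist euclidean_metric (\<omega> t) (\<omega>' t) \<le> 1 * mdist path_metric \<omega> \<omega>'"
        by simp
    qed simp
  qed
  then have "openin (mtopology_of path_metric) {\<omega> \<in> mspace path_metric. \<omega> t \<in> S}"
    using \<open>open S\<close> by (auto simp: continuous_map_def)
  then show "(\<lambda>\<omega>. \<omega> t) -` S \<inter> space path_borel \<in> sets path_borel"
    unfolding sets_path_borel space_path_borel
    by (intro sigma_sets.Basic) (simp add: vimage_def Int_def conj_commute)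
qed

text \<open>\<open>M(\<Omega>)\<close>: arbitrary nonnegative Borel measures, possibly infinite.\<close>

definition path_measures :: "(real \<Rightarrow> 'a::polish_space) measure set" where
  "path_measures = {Q. sets Q = sets path_borel}"

text \<open>
  The sigma-field generated by \<open>X\<^sub>T = (X\<^sub>t)\<^sub>t\<^sub>\<in>\<^sub>T\<close>, i.e. by the map from path space to the product space
  indexed by \<open>T\<close>. Only sets \<open>T \<subseteq> {0..1}\<close> are meaningful.
\<close>

definition sigma_X :: "real set \<Rightarrow> (real \<Rightarrow> 'a::polish_space) measure" where
  "sigma_X T = vimage_algebra (space path_borel) (\<lambda>\<omega>. restrict \<omega> T) (\<Pi>\<^sub>M t\<in>T. borel)"

lemma subalgebra_sigma_X:
  assumes "Q \<in> path_measures" "T \<subseteq> {0..1}"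
  shows "subalgebra Q (sigma_X T)"
proof -
  have "(\<lambda>\<omega>. restrict \<omega> T) \<in> measurable path_borel (\<Pi>\<^sub>M t\<in>T. (borel :: 'a measure))"
    using assms(2) by (intro measurable_restrict measurable_coordinate) auto
  then have "sets (sigma_X T :: (real \<Rightarrow> 'a) measure) \<subseteq> sets path_borel"
    unfolding sigma_X_def
    by (intro sets_image_in_sets) (simp_all add: space_path_borel)
  moreover have "sets Q = sets path_borel"
    using assms(1) by (simp add: path_measures_def)
  ultimately show ?thesis
    using sets_eq_imp_space_eq [of Q path_borel]
    by (simp add: subalgebra_def) (simp add: sigma_X_def)
qed

definition marginal :: "(real \<Rightarrow> 'a::polish_space) measure \<Rightarrow> real \<Rightarrow> 'a measure" where
  "marginal Q t = distr Q borel (\<lambda>\<omega>. \<omega> t)"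

definition conditionable :: "(real \<Rightarrow> 'a::polish_space) measure \<Rightarrow> bool" where
  "conditionable Q \<longleftrightarrow> (\<forall>t\<in>{0..1}. sigma_finite_measure (marginal Q t))"

text \<open>
  \<open>Q(A | X\<^sub>T)\<close>. Since \<open>Q\<close> may be infinite, \<open>indicator A\<close> need not be integrable, so the conditional
  expectation of nonnegative functions is used; it is meaningful as soon as \<open>Q\<close> is sigma-finite on
  \<open>sigma_X T\<close>, which holds for conditionable \<open>Q\<close> and nonempty \<open>T \<subseteq> {0..1}\<close>.
\<close>

definition cond_prob_X ::
  "(real \<Rightarrow> 'a::polish_space) measure \<Rightarrow> real set \<Rightarrow> (real \<Rightarrow> 'a) set \<Rightarrow> (real \<Rightarrow> 'a) \<Rightarrow> ennreal" where
  "cond_prob_X Q T A = nn_cond_exp Q (sigma_X T) (indicator A)"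

lemma sigma_finite_subalgebra_sigma_X:
  fixes Q :: "(real \<Rightarrow> 'a::polish_space) measure"
  assumes Q: "Q \<in> path_measures" "conditionable Q" and T: "T \<subseteq> {0..1}" "t \<in> T"
  shows "sigma_finite_subalgebra Q (sigma_X T)"
proof -
  note sub = subalgebra_sigma_X [OF Q(1) T(1)]
  have setsQ: "sets Q = sets path_borel"
    using Q(1) by (simp add: path_measures_def)
  have X: "(\<lambda>\<omega>. \<omega> t) \<in> measurable Q borel"
    using measurable_coordinate [of t] T unfolding measurable_cong_sets [OF setsQ refl] by blast
  have "(\<lambda>f. f t) \<circ> (\<lambda>\<omega>. restrict \<omega> T) \<in> measurable (sigma_X T) (borel :: 'a measure)"
    unfolding sigma_X_def
    by (rule measurable_comp [OF measurable_vimage_algebra1])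
       (use T in \<open>auto simp: space_PiM\<close>)
  then have XF: "(\<lambda>\<omega>. \<omega> t) \<in> measurable (sigma_X T) (borel :: 'a measure)"
    using T by (simp add: comp_def)
  interpret M: sigma_finite_measure "marginal Q t"
    using Q(2) T by (auto simp: conditionable_def)
  obtain A where A: "countable A" "A \<subseteq> sets (marginal Q t)" "\<Union>A = space (marginal Q t)"
    "\<And>a. a \<in> A \<Longrightarrow> emeasure (marginal Q t) a \<noteq> \<infinity>"
    using M.sigma_finite_countable by blast
  let ?g = "\<lambda>a. (\<lambda>\<omega>. \<omega> t) -` a \<inter> space Q"
  have spF: "space (sigma_X T) = space Q"
    using sub by (simp add: subalgebra_def)
  have gF: "?g a \<in> sets (sigma_X T)" if "a \<in> A" for a
    using measurable_sets [OF XF, of a] A(2) that by (auto simp: spF marginal_def)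
  have "emeasure (restr_to_subalg Q (sigma_X T)) (?g a) \<noteq> \<infinity>" if "a \<in> A" for a
    using A(2) A(4) [OF that] that X
    by (auto simp: emeasure_restr_to_subalg [OF sub gF [OF that]] marginal_def emeasure_distr subset_iff)
  moreover have "\<Union>(?g ` A) = space (restr_to_subalg Q (sigma_X T))"
    using A(3) by (auto simp: space_restr_to_subalg marginal_def)
  ultimately have "sigma_finite_measure (restr_to_subalg Q (sigma_X T))"
    using A(1) gF
    by (intro sigma_finite_measure.intro exI [of _ "?g ` A"] conjI)
      (auto simp: sets_restr_to_subalg [OF sub])
  with sub show ?thesis
    by (rule sigma_finite_subalgebra.intro)
qed

definition markov :: "(real \<Rightarrow> 'a::polish_space) measure \<Rightarrow> bool" where
  "markov Q \<longleftrightarrow> conditionable Q \<and>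
     (\<forall>t\<in>{0..1}. \<forall>A\<in>sets (sigma_X {0..t}). \<forall>B\<in>sets (sigma_X {t..1}).
        AE \<omega> in Q. cond_prob_X Q {t} (A \<inter> B) \<omega> = cond_prob_X Q {t} A \<omega> * cond_prob_X Q {t} B \<omega>)"

definition reciprocal :: "(real \<Rightarrow> 'a::polish_space) measure \<Rightarrow> bool" where
  "reciprocal Q \<longleftrightarrow> conditionable Q \<and>
     (\<forall>s u. 0 < s \<and> s < u \<and> u < 1 \<longrightarrow>
        (\<forall>A\<in>sets (sigma_X ({0..s} \<union> {u..1})). \<forall>B\<in>sets (sigma_X {s..u}).
           AE \<omega> in Q. cond_prob_X Q {s, u} (A \<inter> B) \<omega>
             = cond_prob_X Q {s, u} A \<omega> * cond_prob_X Q {s, u} B \<omega>))"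

definition Psi :: "real \<Rightarrow> (real \<Rightarrow> 'a) \<Rightarrow> real \<Rightarrow> 'a \<times> 'a" where
  "Psi l \<omega> = (\<lambda>t\<in>{0..1}. (\<omega> (l * t), \<omega> (1 - (1 - l) * t)))"

lemma Psi_in_mspace:
  assumes "0 < l" "l < 1" "\<omega> \<in> mspace path_metric"
  shows "Psi l \<omega> \<in> mspace path_metric"
proof -
  have c: "continuous_on {0..1} \<omega>"
    using assms by (simp add: mspace_path_metric)
  have 1: "(\<lambda>t. l * t) ` {0..1} \<subseteq> {0..1}"
    using assms by (auto simp: mult_le_one)
  have 2: "(\<lambda>t. 1 - (1 - l) * t) ` {0..1} \<subseteq> {0..1}"
    using assms by (auto simp: mult_le_one)
  have "continuous_on {0..1} (\<lambda>t. (\<omega> (l * t), \<omega> (1 - (1 - l) * t)))"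
    by (intro continuous_on_Pair continuous_on_compose2 [OF c _ 1] continuous_on_compose2 [OF c _ 2]
        continuous_intros)
  then have "continuous_on {0..1} (Psi l \<omega>)"
    by (rule continuous_on_eq) (simp add: Psi_def)
  then show ?thesis
    by (simp add: mspace_path_metric Psi_def)
qed

lemma measurable_Psi:
  assumes l: "0 < l" "l < 1"
  shows "Psi l \<in> measurable path_borel (path_borel :: (real \<Rightarrow> 'a::polish_space \<times> 'a) measure)"
proof -
  have b: "l * t \<in> {0..1}" "1 - (1 - l) * t \<in> {0..1}" if "t \<in> {0..1}" for t
    using that l by (auto simp: mult_le_one)
  have "mdist path_metric (Psi l \<omega>) (Psi l \<omega>') \<le> 2 * mdist path_metric \<omega> \<omega>'"
    if w: "\<omega> \<in> mspace path_metric" "\<omega>' \<in> mspace path_metric" for \<omega> \<omega>' :: "real \<Rightarrow> 'a"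
    unfolding mdist_path_metric_le [OF Psi_in_mspace [OF l w(1)] Psi_in_mspace [OF l w(2)]]
  proof
    fix t :: real assume t: "t \<in> {0..1}"
    have d: "dist (\<omega> s) (\<omega>' s) \<le> mdist path_metric \<omega> \<omega>'" if "s \<in> {0..1}" for s
      using mdist_path_metric_le [OF w] that by blast
    have "dist (Psi l \<omega> t) (Psi l \<omega>' t)
        \<le> dist (\<omega> (l * t)) (\<omega>' (l * t)) + dist (\<omega> (1 - (1 - l) * t)) (\<omega>' (1 - (1 - l) * t))"
      using t by (simp add: Psi_def dist_Pair_Pair sqrt_sum_squares_le_sum)
    also have "\<dots> \<le> 2 * mdist path_metric \<omega> \<omega>'"
      using d [OF b(1) [OF t]] d [OF b(2) [OF t]] by linarith
    finally show "dist (Psi l \<omega> t) (Psi l \<omega>' t) \<le> 2 * mdist path_metric \<omega> \<omega>'" .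
  qed
  then have "Lipschitz_continuous_map path_metric path_metric (Psi l :: (real \<Rightarrow> 'a) \<Rightarrow> _)"
    unfolding Lipschitz_continuous_map_def using Psi_in_mspace [OF l] by blast
  then have cm: "continuous_map (mtopology_of path_metric) (mtopology_of path_metric)
      (Psi l :: (real \<Rightarrow> 'a) \<Rightarrow> _)"
    by (rule Lipschitz_continuous_imp_continuous_map)
  show ?thesis
    unfolding path_borel_def [where 'a = "'a \<times> 'a"]
  proof (rule measurable_measure_of)
    show "{U. openin (mtopology_of path_metric) U} \<subseteq> Pow (mspace path_metric)"
      by (rule openin_path_subset)
    show "Psi l \<in> space path_borel \<rightarrow> mspace path_metric"
      using Psi_in_mspace [OF l] by (auto simp: space_path_borel)
    fix U :: "(real \<Rightarrow> 'a \<times> 'a) set" assume "U \<in> {U. openin (mtopology_of path_metric) U}"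
    with cm have "openin (mtopology_of path_metric) {\<omega> \<in> mspace path_metric. Psi l \<omega> \<in> U}"
      by (auto simp: continuous_map_def)
    then show "Psi l -` U \<inter> space path_borel \<in> sets path_borel"
      unfolding sets_path_borel space_path_borel
      by (intro sigma_sets.Basic) (simp add: vimage_def Int_def conj_commute)
  qed
qed

end

theory Submission
  imports Defs
begin

text \<open>
  The equivalence is a change of clock. As \<open>t\<close> runs from 0 to 1, the pair of times
  \<open>(l t, 1 - (1 - l) t)\<close> runs from \<open>(0, 1)\<close> to \<open>(l, l)\<close>: the two ends of the unit interval are
  folded onto each other at \<open>l\<close>. Hence the past of the folded process up to \<open>t\<close> is what \<open>X\<close> does
  outside the interval with endpoints \<open>s = l t\<close> and \<open>u = 1 - (1 - l) t\<close>, its future is what \<open>X\<close> does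
  inside, and its present is \<open>(X\<^sub>s, X\<^sub>u)\<close> (\<open>sigma_X_folded\<close>). Conditional probabilities of the image
  measure, composed with \<open>Psi l\<close>, are conditional probabilities of \<open>Q\<close> given the pulled-back
  sigma-field (\<open>nn_cond_exp_distr\<close>), so the Markov property of the folded process at \<open>t\<close> is
  literally the reciprocal property at \<open>(s, u)\<close>.

  Two points complete the argument. Since \<open>u - s = 1 - t\<close>, the map from \<open>(l, t)\<close> to \<open>(s, u)\<close> is a
  bijection from the open unit square onto \<open>{(s, u). 0 < s \<and> s < u \<and> u < 1}\<close>, with inverse
  \<open>t = 1 - (u - s)\<close>, \<open>l = s / t\<close>. And at the two remaining times \<open>t = 0\<close> and \<open>t = 1\<close> the past,
  respectively the future, is already contained in the present, so that the Markov property imposes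
  no condition there (\<open>markov_iff_interior\<close>).
\<close>

section \<open>Conditional expectations under an image measure\<close>

lemma subalgebra_vimage_algebra:
  assumes "T \<in> measurable M N" "subalgebra N F"
  shows "subalgebra M (vimage_algebra (space M) T F)"
proof -
  have "T \<in> measurable M F"
    using assms by (auto simp: measurable_def subalgebra_def)
  then show ?thesis
    by (simp add: subalgebra_def sets_image_in_sets)
qed

lemma measurable_vimage_algebra_self:
  assumes "T \<in> measurable M N" "subalgebra N F"
  shows "T \<in> measurable (vimage_algebra (space M) T F) F"
  using assms by (intro measurable_vimage_algebra1) (auto simp: subalgebra_def measurable_space)

text \<open>
  Restricting to a sub-sigma-field and taking the image commute, and a measure with a sigma-finite
  image is sigma-finite.
\<close>

lemma sigma_finite_subalgebra_vimage_algebra: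
  assumes T: "T \<in> measurable M N" and F: "subalgebra N F"
    and fin: "sigma_finite_subalgebra (distr M N T) F"
  shows "sigma_finite_subalgebra M (vimage_algebra (space M) T F)"
proof -
  let ?G = "vimage_algebra (space M) T F"
  note sub = subalgebra_vimage_algebra [OF T F]
  note meas = measurable_in_subalg [OF sub measurable_vimage_algebra_self [OF T F]]
  have subD: "subalgebra (distr M N T) F"
    using F by (simp add: subalgebra_def)
  have "distr (restr_to_subalg M ?G) F T = restr_to_subalg (distr M N T) F"
  proof (rule measure_eqI)
    show "sets (distr (restr_to_subalg M ?G) F T) = sets (restr_to_subalg (distr M N T) F)"
      by (simp add: sets_restr_to_subalg [OF subD])
    fix A assume "A \<in> sets (distr (restr_to_subalg M ?G) F T)"
    then have A: "A \<in> sets F"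
      by simp
    with F have "A \<in> sets N"
      by (auto simp: subalgebra_def)
    with A show "emeasure (distr (restr_to_subalg M ?G) F T) A
        = emeasure (restr_to_subalg (distr M N T) F) A"
      by (simp add: emeasure_distr meas T emeasure_restr_to_subalg subD sub
          space_restr_to_subalg in_vimage_algebra)
  qed
  moreover have "sigma_finite_measure (restr_to_subalg (distr M N T) F)"
    using fin by (rule sigma_finite_subalgebra.sigma_fin_subalg)
  ultimately have "sigma_finite_measure (restr_to_subalg M ?G)"
    using sigma_finite_measure_distr [OF _ meas] by simp
  with sub show ?thesis
    by (rule sigma_finite_subalgebra.intro)
qed

text \<open>
  By the change of variables formula, \<open>nn_cond_exp (distr M N T) F f \<circ> T\<close> satisfies the identities
  that characterise the conditional expectation of \<open>f \<circ> T\<close> on the pulled-back sigma-field, all of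
  whose elements are preimages of elements of \<open>F\<close>.
\<close>

lemma nn_cond_exp_distr:
  assumes T: "T \<in> measurable M N" and F: "subalgebra N F"
    and fin: "sigma_finite_subalgebra (distr M N T) F"
    and f: "f \<in> borel_measurable N"
    and g: "g \<in> borel_measurable M" "\<And>x. x \<in> space M \<Longrightarrow> g x = f (T x)"
  shows "AE x in M. nn_cond_exp (distr M N T) F f (T x)
    = nn_cond_exp M (vimage_algebra (space M) T F) g x"
proof -
  let ?D = "distr M N T" and ?G = "vimage_algebra (space M) T F"
  let ?h = "nn_cond_exp ?D F f"
  interpret G: sigma_finite_subalgebra M ?G
    by (rule sigma_finite_subalgebra_vimage_algebra [OF T F fin])
  interpret D: sigma_finite_subalgebra ?D F
    by (rule fin)
  have hF: "?h \<in> borel_measurable F"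
    by simp
  have hN: "?h \<in> borel_measurable N"
    by (rule measurable_from_subalg [OF F hF])
  show ?thesis
  proof (rule G.nn_cond_exp_charact)
    fix A assume "A \<in> sets ?G"
    moreover have "T \<in> space M \<rightarrow> space F"
      using T F by (auto simp: subalgebra_def measurable_space)
    ultimately obtain B where B: "B \<in> sets F" and A: "A = T -` B \<inter> space M"
      by (auto simp: sets_vimage_algebra2)
    have BN: "B \<in> sets N"
      using B F by (auto simp: subalgebra_def)
    have "(\<integral>\<^sup>+x\<in>A. g x \<partial>M) = (\<integral>\<^sup>+x. indicator B (T x) * f (T x) \<partial>M)"
      by (rule nn_integral_cong) (auto simp: A g(2) indicator_def)
    also have "\<dots> = (\<integral>\<^sup>+y. indicator B y * f y \<partial>?D)"
      using BN f by (subst nn_integral_distr [OF T]) auto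
    also have "\<dots> = (\<integral>\<^sup>+y. indicator B y * ?h y \<partial>?D)"
      using B f by (intro D.nn_cond_exp_intg [symmetric]) auto
    also have "\<dots> = (\<integral>\<^sup>+x. indicator B (T x) * ?h (T x) \<partial>M)"
      using BN hN by (subst nn_integral_distr [OF T]) auto
    also have "\<dots> = (\<integral>\<^sup>+x\<in>A. ?h (T x) \<partial>M)"
      by (rule nn_integral_cong) (auto simp: A indicator_def)
    finally show "(\<integral>\<^sup>+x\<in>A. g x \<partial>M) = (\<integral>\<^sup>+x\<in>A. ?h (T x) \<partial>M)" .
  next
    show "(\<lambda>x. ?h (T x)) \<in> borel_measurable ?G"
      by (rule measurable_compose [OF measurable_vimage_algebra_self [OF T F] hF])
  qed (rule g(1))
qed

text \<open>
  Hence conditional independence statements can be moved along \<open>T\<close>: this single equivalence turns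
  the Markov property of the folded process into a property of \<open>Q\<close>.
\<close>

lemma cond_factorization_distr_iff:
  assumes T: "T \<in> measurable M N" and F: "subalgebra N F"
    and fin: "sigma_finite_subalgebra (distr M N T) F"
    and A: "A \<in> sets N" and B: "B \<in> sets N"
  defines "G \<equiv> vimage_algebra (space M) T F"
    and "A' \<equiv> T -` A \<inter> space M" and "B' \<equiv> T -` B \<inter> space M"
  shows "(AE y in distr M N T. nn_cond_exp (distr M N T) F (indicator (A \<inter> B)) y
      = nn_cond_exp (distr M N T) F (indicator A) y * nn_cond_exp (distr M N T) F (indicator B) y)
    \<longleftrightarrow> (AE x in M. nn_cond_exp M G (indicator (A' \<inter> B')) x
      = nn_cond_exp M G (indicator A') x * nn_cond_exp M G (indicator B') x)"
    (is "(AE y in _. ?e (A \<inter> B) y = ?e A y * ?e B y) \<longleftrightarrow> ?R")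
proof -
  have e: "?e C \<in> borel_measurable N" for C
    by (rule measurable_from_subalg [OF F]) simp
  have tr: "AE x in M. ?e C (T x) = nn_cond_exp M G (indicator (T -` C \<inter> space M)) x"
    if "C \<in> sets N" for C
    unfolding G_def using that
    by (intro nn_cond_exp_distr [OF T F fin] borel_measurable_indicator measurable_sets [OF T])
      (auto simp: indicator_def)
  have "{y \<in> space N. ?e (A \<inter> B) y = ?e A y * ?e B y} \<in> sets N"
    using e [of A] e [of B] e [of "A \<inter> B"] by measurable
  then have "(AE y in distr M N T. ?e (A \<inter> B) y = ?e A y * ?e B y)
      \<longleftrightarrow> (AE x in M. ?e (A \<inter> B) (T x) = ?e A (T x) * ?e B (T x))"
    by (rule AE_distr_iff [OF T])
  also have "\<dots> \<longleftrightarrow> ?R"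
  proof -
    have "AE x in M. ?e (A \<inter> B) (T x) = nn_cond_exp M G (indicator (A' \<inter> B')) x"
      using tr [of "A \<inter> B"] A B by (simp add: A'_def B'_def vimage_Int Int_ac)
    moreover have "AE x in M. ?e A (T x) = nn_cond_exp M G (indicator A') x"
      "AE x in M. ?e B (T x) = nn_cond_exp M G (indicator B') x"
      using tr [OF A] tr [OF B] by (simp_all add: A'_def B'_def)
    ultimately have "AE x in M. (?e (A \<inter> B) (T x) = ?e A (T x) * ?e B (T x))
      \<longleftrightarrow> (nn_cond_exp M G (indicator (A' \<inter> B')) x
        = nn_cond_exp M G (indicator A') x * nn_cond_exp M G (indicator B') x)"
      by eventually_elim simp
    then show ?thesis
      by (rule eventually_subst)
  qed
  finally show ?thesis .
qed

text \<open>A known event is a constant for the conditional expectation and can be taken out.\<close>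

lemma (in sigma_finite_subalgebra) cond_factorization_known:
  assumes A: "A \<in> sets F" and B: "B \<in> sets M"
  shows "AE x in M. nn_cond_exp M F (indicator (A \<inter> B)) x
    = nn_cond_exp M F (indicator A) x * nn_cond_exp M F (indicator B) x"
proof -
  have "(\<lambda>x. indicator A x * indicator B x) = (indicator (A \<inter> B) :: 'a \<Rightarrow> ennreal)"
    by (auto simp: indicator_def)
  then have "AE x in M. indicator A x * nn_cond_exp M F (indicator B) x
      = nn_cond_exp M F (indicator (A \<inter> B)) x"
    using nn_cond_exp_prod [of "indicator A" "indicator B"] A B by simp
  moreover have "AE x in M. indicator A x = nn_cond_exp M F (indicator A) x"
    using A by (intro nn_cond_exp_F_meas) auto
  ultimately show ?thesis
    by eventually_elim simp
qed

section \<open>Sigma-fields of the canonical and of the folded process\<close>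

lemma space_sigma_X: "space (sigma_X T) = space path_borel"
  by (simp add: sigma_X_def)

lemma measurable_sigma_X_coordinate:
  assumes "t \<in> T"
  shows "(\<lambda>\<omega>. \<omega> t) \<in> measurable (sigma_X T) (borel :: 'a::polish_space measure)"
proof -
  have "(\<lambda>f. f t) \<circ> (\<lambda>\<omega>. restrict \<omega> T) \<in> measurable (sigma_X T) (borel :: 'a measure)"
    unfolding sigma_X_def
    by (rule measurable_comp [OF measurable_vimage_algebra1])
      (use assms in \<open>auto simp: space_PiM\<close>)
  then show ?thesis
    using assms by (simp add: comp_def)
qed

lemma subalgebra_path_borel_sigma_X:
  assumes "T \<subseteq> {0..1}"
  shows "subalgebra path_borel (sigma_X T)"
  using assms by (intro subalgebra_sigma_X) (simp_all add: path_measures_def)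

text \<open>The real times visited by the folded clock during the period \<open>T\<close>.\<close>

definition folded_times :: "real \<Rightarrow> real set \<Rightarrow> real set" where
  "folded_times l T = (\<lambda>t. l * t) ` T \<union> (\<lambda>t. 1 - (1 - l) * t) ` T"

lemma folded_times_singleton: "folded_times l {t} = {l * t, 1 - (1 - l) * t}"
  by (auto simp: folded_times_def)

lemma image_affine_interval:
  fixes a b c d :: real
  assumes "c \<noteq> 0" "a \<le> b"
  shows "(\<lambda>t. d + c * t) ` {a..b}
    = (if c > 0 then {d + c * a..d + c * b} else {d + c * b..d + c * a})"
  using image_affinity_atLeastAtMost [of c d a b] assms by (auto simp: add.commute)

lemma folded_times_past:
  assumes "0 < l" "l < 1" "0 \<le> t"
  shows "folded_times l {0..t} = {0..l * t} \<union> {1 - (1 - l) * t..1}"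
  using assms image_affine_interval [of l 0 t 0] image_affine_interval [of "l - 1" 0 t 1]
  by (simp add: folded_times_def algebra_simps)

lemma folded_times_future:
  assumes "0 < l" "l < 1" "t \<le> 1"
  shows "folded_times l {t..1} = {l * t..1 - (1 - l) * t}"
proof -
  have "folded_times l {t..1} = {l * t..l} \<union> {l..1 - (1 - l) * t}"
    using assms image_affine_interval [of l t 1 0] image_affine_interval [of "l - 1" t 1 1]
    by (simp add: folded_times_def algebra_simps)
  moreover have "l * t \<le> l" "(1 - l) * t \<le> 1 - l"
    using assms by (simp_all add: mult_left_le)
  then have "l * t \<le> l" "l \<le> 1 - (1 - l) * t"
    by linarith+
  ultimately show ?thesis
    by (simp add: ivl_disj_un)
qed

text \<open>
  Both sides are generated by the same coordinates. This uses that \<open>X\<close> takes values in a second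
  countable space: this ensures that the Borel sigma-field of the product state space is generated by
  the two components.
\<close>

lemma sigma_X_folded:
  assumes l: "0 < l" "l < 1" and T: "T \<subseteq> {0..1}"
  shows "vimage_algebra (space path_borel) (Psi l) (sigma_X T)
    = (sigma_X (folded_times l T) :: (real \<Rightarrow> 'a::polish_space) measure)"
    (is "?V = ?S")
proof -
  have Psi_space: "Psi l \<in> space path_borel \<rightarrow> space (path_borel :: (real \<Rightarrow> 'a \<times> 'a) measure)"
    using Psi_in_mspace [OF l] by (auto simp: space_path_borel)
  have "Psi l \<in> measurable ?S (sigma_X T :: (real \<Rightarrow> 'a \<times> 'a) measure)"
    unfolding sigma_X_def [of T]
  proof (rule measurable_vimage_algebra2)
    show "Psi l \<in> space ?S \<rightarrow> space (path_borel :: (real \<Rightarrow> 'a \<times> 'a) measure)"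
      using Psi_space by (simp add: space_sigma_X)
    show "(\<lambda>\<omega>. restrict (Psi l \<omega>) T) \<in> measurable ?S (\<Pi>\<^sub>M t\<in>T. (borel :: ('a \<times> 'a) measure))"
    proof (rule measurable_restrict)
      fix t assume t: "t \<in> T"
      then have "l * t \<in> folded_times l T" "1 - (1 - l) * t \<in> folded_times l T"
        by (auto simp: folded_times_def)
      then have "(\<lambda>\<omega>. (\<omega> (l * t), \<omega> (1 - (1 - l) * t))) \<in> borel_measurable ?S"
        by (intro borel_measurable_Pair measurable_sigma_X_coordinate)
      with t T show "(\<lambda>\<omega>. Psi l \<omega> t) \<in> borel_measurable ?S"
        by (auto simp: Psi_def)
    qed
  qed
  then have le: "sets ?V \<subseteq> sets ?S"
    by (intro sets_image_in_sets) (simp_all add: space_sigma_X)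
  have pair: "(\<lambda>\<omega>. (\<omega> (l * t), \<omega> (1 - (1 - l) * t))) \<in> measurable ?V (borel \<Otimes>\<^sub>M borel)"
    if t: "t \<in> T" for t
  proof -
    have "Psi l \<in> measurable ?V (sigma_X T :: (real \<Rightarrow> 'a \<times> 'a) measure)"
      by (rule measurable_vimage_algebra1) (use Psi_space in \<open>simp add: space_sigma_X\<close>)
    from measurable_compose [OF this measurable_sigma_X_coordinate [OF t]]
    show ?thesis
      using t T by (auto simp: Psi_def borel_prod)
  qed
  have "(\<lambda>\<omega>. restrict \<omega> (folded_times l T)) \<in> measurable ?V (\<Pi>\<^sub>M t\<in>folded_times l T. borel)"
  proof (rule measurable_restrict)
    fix r assume "r \<in> folded_times l T"
    then obtain t where t: "t \<in> T" and "r = l * t \<or> r = 1 - (1 - l) * t"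
      by (auto simp: folded_times_def)
    then show "(\<lambda>\<omega>. \<omega> r) \<in> borel_measurable ?V"
      using measurable_compose [OF pair [OF t] measurable_fst]
        measurable_compose [OF pair [OF t] measurable_snd] by auto
  qed
  then have "sets ?S \<subseteq> sets ?V"
    unfolding sigma_X_def [of "folded_times l T"] by (intro sets_image_in_sets) simp_all
  with le show ?thesis
    \<comment> \<open>as measures, both sides vanish identically\<close>
    by (intro measure_eqI) (auto simp: sigma_X_def vimage_algebra_def emeasure_sigma)
qed

section \<open>The folded path measure\<close>

lemma conditionable_folded:
  fixes Q :: "(real \<Rightarrow> 'a::polish_space) measure"
  assumes l: "0 < l" "l < 1" and Q: "Q \<in> path_measures" "conditionable Q"
  shows "conditionable (distr Q path_borel (Psi l))"
  unfolding conditionable_def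
proof
  fix t :: real assume t: "t \<in> {0..1}"
  let ?D = "distr Q path_borel (Psi l)"
  have setsQ: "sets Q = sets path_borel"
    using Q(1) by (simp add: path_measures_def)
  have Psi: "Psi l \<in> measurable Q path_borel"
    using measurable_Psi [OF l] by (simp add: measurable_cong_sets [OF setsQ refl])
  have lt: "l * t \<in> {0..1}"
    using l t by (auto simp: mult_le_one)
  have fst: "fst \<in> measurable (borel :: ('a \<times> 'a) measure) (borel :: 'a measure)"
    unfolding borel_prod [symmetric] by (rule measurable_fst)
  \<comment> \<open>One sigma-finite component suffices: the law of \<open>(X\<^sub>s, X\<^sub>u)\<close> projects to that of \<open>X\<^sub>s\<close>.\<close>
  have "distr (marginal ?D t) borel fst = marginal Q (l * t)"
  proof -
    have "distr (marginal ?D t) borel fst = distr (distr Q borel (\<lambda>\<omega>. Psi l \<omega> t)) borel fst"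
      using distr_distr [OF measurable_coordinate [OF t] Psi] by (simp add: marginal_def comp_def)
    also have "\<dots> = distr Q borel (\<lambda>\<omega>. fst (Psi l \<omega> t))"
      using distr_distr [OF fst measurable_compose [OF Psi measurable_coordinate [OF t]]]
      by (simp add: comp_def)
    also have "\<dots> = marginal Q (l * t)"
      using t by (simp add: marginal_def Psi_def)
    finally show ?thesis .
  qed
  moreover have "sigma_finite_measure (marginal Q (l * t))"
    using Q(2) lt by (simp add: conditionable_def)
  ultimately show "sigma_finite_measure (marginal ?D t)"
    using fst by (intro sigma_finite_measure_distr [of _ borel fst]) (simp_all add: marginal_def)
qed

text \<open>
  At time 0 the past, and at time 1 the future, is the present itself, so the factorization is
  automatic there.
\<close>

lemma markov_iff_interior:
  fixes Q :: "(real \<Rightarrow> 'a::polish_space) measure"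
  assumes Q: "Q \<in> path_measures" "conditionable Q"
  shows "markov Q \<longleftrightarrow>
    (\<forall>t\<in>{0<..<1}. \<forall>A\<in>sets (sigma_X {0..t}). \<forall>B\<in>sets (sigma_X {t..1}).
      AE \<omega> in Q. cond_prob_X Q {t} (A \<inter> B) \<omega> = cond_prob_X Q {t} A \<omega> * cond_prob_X Q {t} B \<omega>)"
    (is "_ \<longleftrightarrow> (\<forall>t\<in>_. ?P t)")
proof -
  have known: "AE \<omega> in Q. cond_prob_X Q {t} (A \<inter> B) \<omega>
      = cond_prob_X Q {t} A \<omega> * cond_prob_X Q {t} B \<omega>"
    if "t \<in> {0..1}" "A \<in> sets (sigma_X {t})" "B \<in> sets (sigma_X S)" "S \<subseteq> {0..1}" for t A B S
  proof -
    have "sigma_finite_subalgebra Q (sigma_X {t})"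
      using that by (intro sigma_finite_subalgebra_sigma_X [OF Q, of _ t]) auto
    moreover have "B \<in> sets Q"
      using subalgebra_sigma_X [OF Q(1) that(4)] that(3) by (auto simp: subalgebra_def)
    ultimately show ?thesis
      unfolding cond_prob_X_def using that(2)
      by (intro sigma_finite_subalgebra.cond_factorization_known)
  qed
  have "?P 0"
    using known [of 0 _ _ "{0..1}"] by auto
  moreover have "?P 1"
  proof (intro ballI)
    fix A B :: "(real \<Rightarrow> 'a) set"
    assume "A \<in> sets (sigma_X {0..1})" "B \<in> sets (sigma_X {1..1})"
    then show "AE \<omega> in Q. cond_prob_X Q {1} (A \<inter> B) \<omega>
        = cond_prob_X Q {1} A \<omega> * cond_prob_X Q {1} B \<omega>"
      using known [of 1 B A "{0..1}"] by (simp add: Int_commute [of A B] mult.commute)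
  qed
  moreover have "{0..1} = {0<..<1} \<union> {0, 1::real}"
    by auto
  ultimately show ?thesis
    using Q(2) by (simp add: markov_def ball_Un)
qed

lemma markov_folded_iff:
  fixes Q :: "(real \<Rightarrow> 'a::polish_space) measure"
  assumes l: "0 < l" "l < 1" and Q: "Q \<in> path_measures" "conditionable Q"
  shows "markov (distr Q path_borel (Psi l)) \<longleftrightarrow>
    (\<forall>t\<in>{0<..<1}. let s = l * t; u = 1 - (1 - l) * t in
      \<forall>A\<in>sets (sigma_X ({0..s} \<union> {u..1})). \<forall>B\<in>sets (sigma_X {s..u}).
        AE \<omega> in Q. cond_prob_X Q {s, u} (A \<inter> B) \<omega>
          = cond_prob_X Q {s, u} A \<omega> * cond_prob_X Q {s, u} B \<omega>)"
proof -
  let ?D = "distr Q path_borel (Psi l)"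
  have D: "?D \<in> path_measures" "conditionable ?D"
    using conditionable_folded [OF l Q] by (simp_all add: path_measures_def)
  have setsQ: "sets Q = sets path_borel"
    using Q(1) by (simp add: path_measures_def)
  have spQ: "space Q = space path_borel"
    by (rule sets_eq_imp_space_eq [OF setsQ])
  have Psi: "Psi l \<in> measurable Q path_borel"
    using measurable_Psi [OF l] by (simp add: measurable_cong_sets [OF setsQ refl])
  let ?pull = "\<lambda>A :: (real \<Rightarrow> 'a \<times> 'a) set. Psi l -` A \<inter> space Q"
  have pulled: "sets (sigma_X (folded_times l T)) = ?pull ` sets (sigma_X T)"
    if "T \<subseteq> {0..1}" for T
  proof -
    have "Psi l \<in> space path_borel \<rightarrow> space (sigma_X T :: (real \<Rightarrow> 'a \<times> 'a) measure)"
      using Psi_in_mspace [OF l] by (auto simp: space_path_borel space_sigma_X)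
    then show ?thesis
      unfolding sigma_X_folded [OF l that, symmetric] spQ
      by (auto simp: sets_vimage_algebra2)
  qed
  have transfer: "(\<forall>A\<in>sets (sigma_X {0..t}). \<forall>B\<in>sets (sigma_X {t..1}).
      AE \<omega> in ?D. cond_prob_X ?D {t} (A \<inter> B) \<omega> = cond_prob_X ?D {t} A \<omega> * cond_prob_X ?D {t} B \<omega>)
    \<longleftrightarrow> (\<forall>A\<in>sets (sigma_X (folded_times l {0..t})). \<forall>B\<in>sets (sigma_X (folded_times l {t..1})).
      AE \<omega> in Q. cond_prob_X Q (folded_times l {t}) (A \<inter> B) \<omega>
        = cond_prob_X Q (folded_times l {t}) A \<omega> * cond_prob_X Q (folded_times l {t}) B \<omega>)"
    if t: "t \<in> {0<..<1}" for t
  proof -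
    have T: "{0..t} \<subseteq> {0..1}" "{t..1} \<subseteq> {0..1}" "{t} \<subseteq> {0..1}"
      using t by auto
    have fin: "sigma_finite_subalgebra ?D (sigma_X {t})"
      using t by (intro sigma_finite_subalgebra_sigma_X [OF D, of _ t]) auto
    have N: "C \<in> sets path_borel" if "C \<in> sets (sigma_X S)" "S \<subseteq> {0..1}"
      for C :: "(real \<Rightarrow> 'a \<times> 'a) set" and S
      using subalgebra_path_borel_sigma_X [OF that(2)] that(1) by (auto simp: subalgebra_def)
    show ?thesis
      unfolding pulled [OF T(1)] pulled [OF T(2)] cond_prob_X_def
        sigma_X_folded [OF l T(3), symmetric] spQ [symmetric]
      unfolding Set.ball_simps(9)
      by (intro ball_cong refl cond_factorization_distr_iff Psi fin
          subalgebra_path_borel_sigma_X T N [OF _ T(1)] N [OF _ T(2)])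
  qed
  show ?thesis
    unfolding markov_iff_interior [OF D] Let_def
  proof (rule ball_cong [OF refl])
    fix t :: real assume t: "t \<in> {0<..<1}"
    then have "0 \<le> t" "t \<le> 1"
      by auto
    from transfer [OF t, unfolded folded_times_singleton folded_times_past [OF l this(1)]
        folded_times_future [OF l this(2)]]
    show "(\<forall>A\<in>sets (sigma_X {0..t}). \<forall>B\<in>sets (sigma_X {t..1}).
        AE \<omega> in ?D. cond_prob_X ?D {t} (A \<inter> B) \<omega> = cond_prob_X ?D {t} A \<omega> * cond_prob_X ?D {t} B \<omega>)
      \<longleftrightarrow> (\<forall>A\<in>sets (sigma_X ({0..l * t} \<union> {1 - (1 - l) * t..1})).
        \<forall>B\<in>sets (sigma_X {l * t..1 - (1 - l) * t}).
        AE \<omega> in Q. cond_prob_X Q {l * t, 1 - (1 - l) * t} (A \<inter> B) \<omega>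
          = cond_prob_X Q {l * t, 1 - (1 - l) * t} A \<omega> * cond_prob_X Q {l * t, 1 - (1 - l) * t} B \<omega>)" .
  qed
qed

section \<open>Reciprocal measures are those with Markov foldings\<close>

text \<open>
  The folded clock reaches every pair \<open>s < u\<close> of interior times, at exactly one \<open>(l, t)\<close>: since
  \<open>u - s = 1 - t\<close>, necessarily \<open>t = 1 - (u - s)\<close> and \<open>l = s / t\<close>.
\<close>

lemma all_interior_pairs_iff:
  fixes P :: "real \<Rightarrow> real \<Rightarrow> bool"
  shows "(\<forall>s u. 0 < s \<and> s < u \<and> u < 1 \<longrightarrow> P s u)
    \<longleftrightarrow> (\<forall>l\<in>{0<..<1}. \<forall>t\<in>{0<..<1}. P (l * t) (1 - (1 - l) * t))"
proof (intro iffI ballI allI impI)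
  fix l t :: real
  assume P: "\<forall>s u. 0 < s \<and> s < u \<and> u < 1 \<longrightarrow> P s u" and "l \<in> {0<..<1}" "t \<in> {0<..<1}"
  then have "0 < l * t" "0 < (1 - l) * t" "t < 1"
    by auto
  then have "0 < l * t \<and> l * t < 1 - (1 - l) * t \<and> 1 - (1 - l) * t < 1"
    by (simp add: algebra_simps)
  with P show "P (l * t) (1 - (1 - l) * t)"
    by blast
next
  fix s u :: real
  assume P: "\<forall>l\<in>{0<..<1}. \<forall>t\<in>{0<..<1}. P (l * t) (1 - (1 - l) * t)"
    and su: "0 < s \<and> s < u \<and> u < 1"
  define t where "t = 1 - (u - s)"
  have t: "0 < t" "t < 1" "s < t"
    using su by (auto simp: t_def)
  moreover have "s / t * t = s" "1 - (1 - s / t) * t = u"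
    using t by (simp_all add: left_diff_distrib) (simp add: t_def)
  moreover have "s / t \<in> {0<..<1}"
    using su t by simp
  ultimately show "P s u"
    using P by (metis greaterThanLessThan_iff)
qed

theorem lemma5p3:
  fixes Q :: "(real \<Rightarrow> 'a::polish_space) measure"
  assumes "Q \<in> path_measures" and "conditionable Q"
  shows "reciprocal Q \<longleftrightarrow> (\<forall>l\<in>{0<..<1}. markov (distr Q path_borel (Psi l)))"
proof -
  let ?R = "\<lambda>s u. \<forall>A\<in>sets (sigma_X ({0..s} \<union> {u..1})). \<forall>B\<in>sets (sigma_X {s..u}).
    AE \<omega> in Q. cond_prob_X Q {s, u} (A \<inter> B) \<omega>
      = cond_prob_X Q {s, u} A \<omega> * cond_prob_X Q {s, u} B \<omega>"
  have "reciprocal Q \<longleftrightarrow> (\<forall>s u. 0 < s \<and> s < u \<and> u < 1 \<longrightarrow> ?R s u)"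
    by (simp only: reciprocal_def assms(2) simp_thms)
  also have "\<dots> \<longleftrightarrow> (\<forall>l\<in>{0<..<1}. \<forall>t\<in>{0<..<1}. ?R (l * t) (1 - (1 - l) * t))"
    by (rule all_interior_pairs_iff)
  also have "\<dots> \<longleftrightarrow> (\<forall>l\<in>{0<..<1}. markov (distr Q path_borel (Psi l)))"
  proof (rule ball_cong [OF refl])
    fix l :: real assume "l \<in> {0<..<1}"
    then have "0 < l" "l < 1"
      by auto
    from markov_folded_iff [OF this assms, symmetric]
    show "(\<forall>t\<in>{0<..<1}. ?R (l * t) (1 - (1 - l) * t)) \<longleftrightarrow> markov (distr Q path_borel (Psi l))"
      unfolding Let_def .
  qed
  finally show ?thesis .
qed

end
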